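(* Let $n$ be a multiple of $5$. Consider the position of $n$-Sim in which the board is decomposed into $n/5$ disjoint drawn $K_5$'s: the $n$ vertices are partitioned into $n/5$ disjoint sets of size $5$, each of these sets carries a drawn $K_5$ on its vertices, every edge joining vertices in two different sets is uncoloured, and it is PI's turn to move. Then this position is a second-player (PII) win.
   Context: The game $n$-Sim: the board is the complete graph on $n$ vertices. Two players, PI and PII, alternately colour one previously uncoloured edge, PI moving first; PI colours edges green and PII colours edges red. The first player to complete a triangle all of whose edges are in his own colour loses (the game ends immediately). If all edges are coloured with no monochromatic triangle, the game is a draw (this cannot happen for $n\ge 6$). A position is a partial colouring of the edges by green and red containing no monochromatic triangle. The player to move is determined by the edge counts: PI moves if the numbers of green and red edges are equal, and PII moves if there is exactly one more green edge than red. A position is a "PII win" (respectively "PI win") if PII (respectively PI) has a winning strategy when play continues from that position. A "drawn $K_5$" on a set of five vertices is a colouring of all ten edges among them in which the five green edges form a 5-cycle and the five red edges form the complementary 5-cycle (this is the unique colouring of $K_5$ in two colours without a monochromatic triangle, up to isomorphism).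
   Formalization: The formal theorem assumes n ≥ 6, so the multiples n = 0 and n = 5 are excluded: for n = 5 the board is a single fully coloured drawn K_5, which is a draw and not a PII win, and n = 0 is the empty board, also a draw. *)

theory Defs
  imports Main "HOL-Library.Disjoint_Sets"
begin

definition edges :: "'a set \<Rightarrow> 'a set set" where
  "edges V = {e. e \<subseteq> V \<and> card e = 2}"

definition has_triangle :: "'a set set \<Rightarrow> bool" where
  "has_triangle C \<longleftrightarrow>
     (\<exists>a b c. a \<noteq> b \<and> b \<noteq> c \<and> a \<noteq> c \<and> {a, b} \<in> C \<and> {b, c} \<in> C \<and> {a, c} \<in> C)"


datatype player = PI | PII

fun opponent :: "player \<Rightarrow> player" where
  "opponent PI = PII"
| "opponent PII = PI"

record 'a colouring =
  green :: "'a set set"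
  red :: "'a set set"

fun own_edges :: "player \<Rightarrow> 'a colouring \<Rightarrow> 'a set set" where
  "own_edges PI p = green p"
| "own_edges PII p = red p"

definition uncoloured :: "'a set \<Rightarrow> 'a colouring \<Rightarrow> 'a set set" where
  "uncoloured V p = edges V - (green p \<union> red p)"

definition is_position :: "'a set \<Rightarrow> 'a colouring \<Rightarrow> bool" where
  "is_position V p \<longleftrightarrow>
     green p \<subseteq> edges V \<and> red p \<subseteq> edges V \<and> green p \<inter> red p = {} \<and>
     \<not> has_triangle (green p) \<and> \<not> has_triangle (red p) \<and>
     (card (green p) = card (red p) \<or> card (green p) = card (red p) + 1)"

definition to_move :: "'a colouring \<Rightarrow> player" where
  "to_move p = (if card (green p) = card (red p) then PI else PII)"

definition make_move :: "'a set \<Rightarrow> 'a colouring \<Rightarrow> 'a colouring" where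
  "make_move e p = (case to_move p of
       PI \<Rightarrow> p\<lparr>green := insert e (green p)\<rparr>
     | PII \<Rightarrow> p\<lparr>red := insert e (red p)\<rparr>)"

definition has_lost :: "player \<Rightarrow> 'a colouring \<Rightarrow> bool" where
  "has_lost w p \<longleftrightarrow> has_triangle (own_edges w p)"

definition game_over :: "'a set \<Rightarrow> 'a colouring \<Rightarrow> bool" where
  "game_over V p \<longleftrightarrow> has_lost PI p \<or> has_lost PII p \<or> uncoloured V p = {}"

definition after :: "'a colouring \<Rightarrow> 'a set list \<Rightarrow> 'a colouring" where
  "after p es = fold make_move es p"

text \<open>Legal (possibly unfinished) plays from \<open>p\<close>, as lists of edges in the order in which
  they are coloured. The player making each move is determined by \<^const>\<open>to_move\<close>.\<close>

inductive legal_play :: "'a set \<Rightarrow> 'a colouring \<Rightarrow> 'a set list \<Rightarrow> bool"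
  for V :: "'a set" and p :: "'a colouring" where
  "legal_play V p []"
| "\<lbrakk>legal_play V p es; \<not> game_over V (after p es); e \<in> uncoloured V (after p es)\<rbrakk>
     \<Longrightarrow> legal_play V p (es @ [e])"

text \<open>A strategy maps the sequence of moves made so far to the next edge to be coloured.\<close>

type_synonym 'a strategy = "'a set list \<Rightarrow> 'a set"

definition follows :: "'a colouring \<Rightarrow> player \<Rightarrow> 'a strategy \<Rightarrow> 'a set list \<Rightarrow> bool" where
  "follows p w \<sigma> es \<longleftrightarrow>
     (\<forall>i < length es. to_move (after p (take i es)) = w \<longrightarrow> es ! i = \<sigma> (take i es))"

text \<open>The first conjunct makes the strategy always prescribe a legal move; without it, a strategy
  naming an unavailable edge would have too few finished plays for the second conjunct to matter.
  For finite \<open>V\<close> every play ends, so the second conjunct governs all maximal plays; a draw does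
  not satisfy it.\<close>

definition winning_strategy ::
    "'a set \<Rightarrow> 'a colouring \<Rightarrow> player \<Rightarrow> 'a strategy \<Rightarrow> bool" where
  "winning_strategy V p w \<sigma> \<longleftrightarrow>
     (\<forall>es. legal_play V p es \<and> follows p w \<sigma> es \<longrightarrow>
        (\<not> game_over V (after p es) \<and> to_move (after p es) = w
            \<longrightarrow> \<sigma> es \<in> uncoloured V (after p es)) \<and>
        (game_over V (after p es) \<longrightarrow> has_lost (opponent w) (after p es)))"

definition is_win_for :: "player \<Rightarrow> 'a set \<Rightarrow> 'a colouring \<Rightarrow> bool" where
  "is_win_for w V p \<longleftrightarrow> (\<exists>\<sigma>. winning_strategy V p w \<sigma>)"

text \<open>A completely coloured board without a monochromatic triangle is a draw. In particular
  a single drawn \<open>K\<^sub>5\<close> (and the empty board) is not a win for either player.\<close>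

lemma full_board_not_win:
  assumes "is_position V p" and "uncoloured V p = {}"
  shows "\<not> is_win_for w V p"
proof
  assume "is_win_for w V p"
  then obtain \<sigma> where s: "winning_strategy V p w \<sigma>"
    unfolding is_win_for_def by blast
  have "legal_play V p []" by (rule legal_play.intros)
  moreover have "follows p w \<sigma> []" by (simp add: follows_def)
  moreover have "game_over V (after p [])"
    using assms(2) by (simp add: game_over_def after_def)
  ultimately have "has_lost (opponent w) (after p [])"
    using s unfolding winning_strategy_def by blast
  then show False
    using assms(1) by (cases w) (simp_all add: has_lost_def after_def is_position_def)
qed

definition five_cycle :: "'a set \<Rightarrow> 'a set set \<Rightarrow> bool" where
  "five_cycle S C \<longleftrightarrow>
     (\<exists>v :: nat \<Rightarrow> 'a. bij_betw v {..<5} S \<and> C = {{v i, v ((i + 1) mod 5)} | i. i < 5})"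

definition drawn_K5 :: "'a colouring \<Rightarrow> 'a set \<Rightarrow> bool" where
  "drawn_K5 p S \<longleftrightarrow>
     card S = 5 \<and>
     five_cycle S (green p \<inter> edges S) \<and>
     five_cycle S (red p \<inter> edges S) \<and>
     red p \<inter> edges S = edges S - green p"

definition drawn_K5_decomposition :: "'a set \<Rightarrow> 'a set set \<Rightarrow> 'a colouring \<Rightarrow> bool" where
  "drawn_K5_decomposition V P p \<longleftrightarrow>
     partition_on V P \<and>
     (\<forall>S \<in> P. drawn_K5 p S) \<and>
     (\<forall>S \<in> P. \<forall>T \<in> P. S \<noteq> T \<longrightarrow> (\<forall>u \<in> S. \<forall>v \<in> T. {u, v} \<in> uncoloured V p))"

end

theory Submission
  imports Defs
begin

text \<open>
  Since a finished board has a monochromatic triangle, the game is equivalent to the one where a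
  player without a safe move loses. The position is isomorphic to the one with the colours exchanged,
  so strategy stealing applies. Suppose PI wins by colouring \<open>e = {u, v}\<close> green. Let
  \<open>f = {u, v'}\<close> with \<open>{v, v'}\<close> green. Some colour-exchanging symmetry maps \<open>e\<close> to \<open>f\<close>, so if
  PII were to start he would win by colouring \<open>f\<close> red; in particular, with \<open>e\<close> green and \<open>f\<close> red,
  PII wins when he is to move. But once \<open>e\<close> is green, PI can never use \<open>f\<close>, so giving \<open>f\<close> to PII for
  free does not hurt PI, who therefore also wins with \<open>e\<close> green, \<open>f\<close> red and PII to move.
\<close>

subsection \<open>The game in which a player without a safe move loses\<close>

text \<open>The player to move owns the edges \<open>A\<close>, his opponent owns \<open>B\<close>, and \<open>U\<close> is the set of
  uncoloured edges.\<close>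

context
  notes conj_cong [fundef_cong]
begin

function mover_wins :: "'a set set \<Rightarrow> 'a set set \<Rightarrow> 'a set set \<Rightarrow> bool" where
  "mover_wins U A B \<longleftrightarrow> finite U \<and>
     (\<exists>e\<in>U. \<not> has_triangle (insert e A) \<and> \<not> mover_wins (U - {e}) B (insert e A))"
  by auto
termination
  \<comment> \<open>The congruence rule \<open>conj_cong\<close> hands \<open>finite U\<close> to
    the recursive call; together with \<open>e \<in> U\<close> this makes the cardinality drop
    strictly.\<close>
  by (relation "measure (\<lambda>(U, _, _). card U)") (auto dest: card_Diff1_less)

end

declare mover_wins.simps [simp del]

section \<open>Giving away an edge that is dead for its receiver's opponent\<close>

lemma has_triangle_mono: "has_triangle A \<Longrightarrow> A \<subseteq> B \<Longrightarrow> has_triangle B"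
  unfolding has_triangle_def by blast

lemma mover_winsI:
  assumes "finite U" and "e \<in> U" and "\<not> has_triangle (insert e A)"
    and "\<not> mover_wins (U - {e}) B (insert e A)"
  shows "mover_wins U A B"
  by (subst mover_wins.simps) (use assms in blast)

lemma mover_winsE:
  assumes "mover_wins U A B"
  obtains e where "e \<in> U" "\<not> has_triangle (insert e A)"
    "\<not> mover_wins (U - {e}) B (insert e A)"
proof -
  have "\<exists>e\<in>U. \<not> has_triangle (insert e A) \<and> \<not> mover_wins (U - {e}) B (insert e A)"
    using assms by (subst (asm) mover_wins.simps) (rule conjunct2)
  then show thesis using that by blast
qed

text \<open>The owner of \<open>A\<close> can never safely colour \<open>f\<close>, so handing
  \<open>f\<close> to the other side takes no option from him, while the owner of \<open>B\<close>
  loses an option and becomes more exposed to triangles. Parity is irrelevant, since the player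
  without a safe move loses. The two halves, one for each player to move, feed each other in the
  induction.\<close>

lemma mover_wins_give_dead_edge:
  assumes "finite U" and "f \<in> U" and "has_triangle (insert f A)"
  shows "(mover_wins U A B \<longrightarrow> mover_wins (U - {f}) A (insert f B)) \<and>
    (\<not> mover_wins U B A \<longrightarrow> \<not> mover_wins (U - {f}) (insert f B) A)"
  using assms
proof (induction "card U" arbitrary: U A B rule: less_induct)
  case less
  show ?case
  proof (intro conjI impI notI)
    assume "mover_wins U A B"
    then obtain e where e: "e \<in> U" "\<not> has_triangle (insert e A)"
        "\<not> mover_wins (U - {e}) B (insert e A)"
      by (rule mover_winsE)
    have "e \<noteq> f" using e(2) less.prems(3) by blast
    \<comment> \<open>The edge \<open>f\<close> stays dead as \<open>A\<close> grows, so the second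
      half of the induction hypothesis applies after the winning move \<open>e\<close>.\<close>
    have "has_triangle (insert f (insert e A))"
      using less.prems(3) by (rule has_triangle_mono) blast
    then have "\<not> mover_wins (U - {e} - {f}) (insert f B) (insert e A)"
      using less.hyps[OF card_Diff1_less[OF less.prems(1) e(1)]] e(3) less.prems(1,2) \<open>e \<noteq> f\<close>
      by simp
    moreover have "U - {e} - {f} = U - {f} - {e}" by blast
    ultimately show "mover_wins (U - {f}) A (insert f B)"
      using e \<open>e \<noteq> f\<close> less.prems(1) by (intro mover_winsI[of _ e]) simp_all
  next
    assume lost: "\<not> mover_wins U B A"
    assume "mover_wins (U - {f}) (insert f B) A"
    then obtain g where g: "g \<in> U - {f}" "\<not> has_triangle (insert g (insert f B))"
        "\<not> mover_wins (U - {f} - {g}) A (insert g (insert f B))"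
      by (rule mover_winsE)
    have "g \<in> U" using g(1) by blast
    \<comment> \<open>A move that is safe while holding \<open>f\<close> is also safe without it.
      Hence \<open>g\<close> was already available before the gift, and the owner of
      \<open>A\<close> had a winning answer to it.\<close>
    have "\<not> has_triangle (insert g B)"
      using g(2) has_triangle_mono[of "insert g B" "insert g (insert f B)"] by blast
    then have "mover_wins (U - {g}) A (insert g B)"
      using lost mover_winsI[OF less.prems(1) \<open>g \<in> U\<close>] by blast
    then have "mover_wins (U - {g} - {f}) A (insert f (insert g B))"
      using less.hyps[OF card_Diff1_less[OF less.prems(1) \<open>g \<in> U\<close>], of A "insert g B"] g(1)
        less.prems by auto
    moreover have "U - {g} - {f} = U - {f} - {g}" by blast
    moreover have "insert f (insert g B) = insert g (insert f B)" by blast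
    ultimately show False using g(3) by simp
  qed
qed

lemma mover_loses_despite_dead_edge:
  assumes "finite U" and "f \<in> U" and "has_triangle (insert f A)" and "\<not> mover_wins U B A"
  shows "\<not> mover_wins (U - {f}) (insert f B) A"
  using mover_wins_give_dead_edge[OF assms(1-3)] assms(4) by blast

section \<open>Invariance under relabelling the vertices\<close>

lemma image_image_mem_iff:
  assumes "inj t"
  shows "t ` e \<in> (`) t ` A \<longleftrightarrow> e \<in> A"
  using assms by (auto simp: inj_image_eq_iff)

lemma has_triangle_image:
  assumes "bij t"
  shows "has_triangle ((`) t ` A) \<longleftrightarrow> has_triangle A"
proof -
  \<comment> \<open>Surjectivity of \<open>t\<close> lets each of the three vertex quantifiers of
    \<open>has_triangle\<close> range over images under \<open>t\<close>.\<close>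
  have surj: "(\<exists>x. Q x) \<longleftrightarrow> (\<exists>x. Q (t x))" for Q
    using bij_is_surj[OF assms] by (metis surjD)
  have "{t x, t y} \<in> (`) t ` A \<longleftrightarrow> {x, y} \<in> A" for x y
    using image_image_mem_iff[OF bij_is_inj[OF assms], of "{x, y}" A] by simp
  moreover have "t x = t y \<longleftrightarrow> x = y" for x y
    using bij_is_inj[OF assms] by (simp add: inj_eq)
  ultimately show ?thesis
    unfolding has_triangle_def by (subst (1 2 3) surj) simp
qed

lemma mover_wins_image:
  assumes "bij t" and "finite U"
  shows "mover_wins ((`) t ` U) ((`) t ` A) ((`) t ` B) \<longleftrightarrow> mover_wins U A B"
  using assms(2)
proof (induction "card U" arbitrary: U A B rule: less_induct)
  case less
  have inj: "inj ((`) t)"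
    using bij_is_inj[OF assms(1)] by (simp add: inj_def inj_image_eq_iff)
  have tri: "has_triangle (insert (t ` e) ((`) t ` A)) \<longleftrightarrow> has_triangle (insert e A)" for e
    using has_triangle_image[OF assms(1), of "insert e A"] by simp
  have "mover_wins ((`) t ` U - {t ` e}) ((`) t ` B) (insert (t ` e) ((`) t ` A)) \<longleftrightarrow>
      mover_wins (U - {e}) B (insert e A)" if "e \<in> U" for e
  proof -
    have "(`) t ` U - {t ` e} = (`) t ` (U - {e})"
      using inj by (simp add: image_set_diff)
    then show ?thesis
      using less.hyps[of "U - {e}" B "insert e A"] less.prems card_Diff1_less[OF less.prems that]
      by simp
  qed
  then show ?case
    using less.prems tri
    by (subst (1 2) mover_wins.simps) auto
qed

text \<open>Strategy stealing in abstract form; the symmetry \<open>t\<close> may depend on the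
  opening move \<open>e\<close>. The contradiction arises in one position, \<open>insert e A\<close>
  against \<open>insert f B\<close> with the owner of \<open>B\<close> to move: the free edge leaves
  him losing, the symmetry makes him win.\<close>

lemma not_mover_wins_self_dual:
  assumes "finite U"
    and symmetric: "\<And>e. e \<in> U \<Longrightarrow> \<not> has_triangle (insert e A) \<Longrightarrow>
      \<exists>t f. bij t \<and> (`) t ` U = U \<and> (`) t ` A = B \<and> (`) t ` B = A \<and> t ` e = f \<and>
        f \<noteq> e \<and> has_triangle (insert f (insert e A))"
  shows "\<not> mover_wins U A B"
proof
  assume "mover_wins U A B"
  then obtain e where e: "e \<in> U" "\<not> has_triangle (insert e A)"
      "\<not> mover_wins (U - {e}) B (insert e A)"
    by (subst (asm) mover_wins.simps) blast
  obtain t f where t: "bij t" "(`) t ` U = U" "(`) t ` A = B" "(`) t ` B = A" "t ` e = f"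
    and f: "f \<noteq> e" "has_triangle (insert f (insert e A))"
    using symmetric[OF e(1,2)] by (elim exE conjE) (rule that)
  have "f \<in> U" using imageI[OF e(1), of "(`) t"] t(2,5) by simp
  \<comment> \<open>After \<open>e\<close> the owner of \<open>B\<close> is lost, and receiving the
    dead edge \<open>f\<close> does not save him.\<close>
  have "\<not> mover_wins (U - {e} - {f}) (insert f B) (insert e A)"
    using mover_loses_despite_dead_edge[OF _ _ f(2) e(3)] assms(1) \<open>f \<in> U\<close> f(1) by blast
  moreover have "(`) t ` (U - {e}) = U - {f}"
    using t bij_is_inj[OF t(1)] by (simp add: image_set_diff inj_def inj_image_eq_iff)
  \<comment> \<open>Mirror image under \<open>t\<close> of the winning opening \<open>e\<close>: if
    the owner of \<open>B\<close> opens with \<open>f\<close>, then the owner of \<open>A\<close> is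
    lost. In particular his safe reply \<open>e\<close> fails, which is the next step.\<close>
  then have "\<not> mover_wins (U - {f}) A (insert f B)"
    using mover_wins_image[OF t(1), of "U - {e}" B "insert e A"] assms(1) e(3) t by simp
  then have "mover_wins (U - {f} - {e}) (insert f B) (insert e A)"
    using e(1,2) f(1) assms(1) by (subst (asm) mover_wins.simps) auto
  moreover have "U - {f} - {e} = U - {e} - {f}" by blast
  ultimately show False by simp
qed

subsection \<open>Relation to the real game\<close>

lemma doubleton_in_edges [simp]: "{x, y} \<in> edges V \<longleftrightarrow> x \<in> V \<and> y \<in> V \<and> x \<noteq> y"
  by (auto simp: edges_def card_insert_if)

lemma edgesE:
  assumes "e \<in> edges V"
  obtains x y where "e = {x, y}" "x \<in> V" "y \<in> V" "x \<noteq> y"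
  using assms unfolding edges_def card_2_iff by blast

text \<open>This excludes draws. Among at least five edges at a vertex, three are covered by the
  same set; either two of their far ends are joined in that set, or the three far ends form a
  triangle in the other.\<close>

lemma Ramsey_3_3:
  assumes "finite V" and "card V \<ge> 6" and "edges V \<subseteq> A \<union> B"
  shows "has_triangle A \<or> has_triangle B"
proof -
  have triangle_at: "has_triangle C \<or> has_triangle D"
    if x: "x \<in> V" and degree: "card {y \<in> V - {x}. {x, y} \<in> C} \<ge> 3"
      and cover: "edges V \<subseteq> C \<union> D" for x C D
  proof -
    obtain N where "N \<subseteq> {y \<in> V - {x}. {x, y} \<in> C}" "card N = 3"
      using degree by (meson obtain_subset_with_card_n)
    then obtain a b c where abc: "a \<noteq> b" "b \<noteq> c" "a \<noteq> c" "{a, b, c} \<subseteq> V - {x}"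
        "{x, a} \<in> C" "{x, b} \<in> C" "{x, c} \<in> C"
      by (auto simp: card_3_iff)
    then have "{a, b} \<in> edges V" "{b, c} \<in> edges V" "{a, c} \<in> edges V" by auto
    then have "{a, b} \<in> C \<union> D" "{b, c} \<in> C \<union> D" "{a, c} \<in> C \<union> D"
      using cover by blast+
    moreover have "x \<noteq> a" "x \<noteq> b" "x \<noteq> c" using abc by auto
    ultimately show ?thesis
      using abc unfolding has_triangle_def by (metis Un_iff)
  qed
  obtain x where x: "x \<in> V" using assms(2) by fastforce
  have "V - {x} \<subseteq> {y \<in> V - {x}. {x, y} \<in> A} \<union> {y \<in> V - {x}. {x, y} \<in> B}"
  proof
    fix y assume "y \<in> V - {x}"
    then have "{x, y} \<in> edges V" using x by auto
    then show "y \<in> {y \<in> V - {x}. {x, y} \<in> A} \<union> {y \<in> V - {x}. {x, y} \<in> B}"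
      using \<open>y \<in> V - {x}\<close> assms(3) by blast
  qed
  then have "card (V - {x}) \<le>
      card {y \<in> V - {x}. {x, y} \<in> A} + card {y \<in> V - {x}. {x, y} \<in> B}"
    using assms(1) by (intro order_trans[OF card_mono card_Un_le]) auto
  moreover have "card (V - {x}) \<ge> 5" using assms x by simp
  ultimately consider "card {y \<in> V - {x}. {x, y} \<in> A} \<ge> 3" | "card {y \<in> V - {x}. {x, y} \<in> B} \<ge> 3"
    by linarith
  then show ?thesis
    using triangle_at[OF x, of A B] triangle_at[OF x, of B A] assms(3) by cases (auto simp: Un_commute)
qed

section \<open>From the recursion to strategies\<close>

lemma finite_edges: "finite V \<Longrightarrow> finite (edges V)"
  by (auto simp: edges_def intro: finite_subset[of _ "Pow V"])

lemma after_snoc: "after p (es @ [e]) = make_move e (after p es)"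
  by (simp add: after_def)

lemma follows_snoc:
  "follows p w s (es @ [e]) \<longleftrightarrow>
     follows p w s es \<and> (to_move (after p es) = w \<longrightarrow> e = s es)"
  unfolding follows_def by (auto simp: less_Suc_eq nth_append)

definition PII_reply :: "'a set \<Rightarrow> 'a colouring \<Rightarrow> 'a set \<Rightarrow> bool" where
  "PII_reply V q e \<longleftrightarrow> e \<in> uncoloured V q \<and> \<not> has_triangle (insert e (red q)) \<and>
     \<not> mover_wins (uncoloured V q - {e}) (green q) (insert e (red q))"

text \<open>The invariant to be kept by PII's strategy. As \<open>mover_wins\<close> takes the
  mover's edges first, the two colours trade places with the turn.\<close>

definition PII_wins_from :: "'a set \<Rightarrow> 'a colouring \<Rightarrow> bool" where
  "PII_wins_from V q \<longleftrightarrow>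
     (case to_move q of
        PI \<Rightarrow> \<not> mover_wins (uncoloured V q) (green q) (red q)
      | PII \<Rightarrow> mover_wins (uncoloured V q) (red q) (green q))"

text \<open>PI may colour any free edge, whereas \<open>mover_wins\<close> only ranges over safe
  ones; an unsafe move by PI accounts for the first disjunct.\<close>

lemma PII_wins_from_move:
  assumes "finite V" and "is_position V q" and "PII_wins_from V q" and "e \<in> uncoloured V q"
    and "to_move q = PII \<Longrightarrow> PII_reply V q e"
  shows "has_lost PI (make_move e q) \<or>
    is_position V (make_move e q) \<and> PII_wins_from V (make_move e q)"
proof -
  have pos: "green q \<subseteq> edges V" "red q \<subseteq> edges V" "green q \<inter> red q = {}"
      "\<not> has_triangle (green q)" "\<not> has_triangle (red q)"
      "card (green q) = card (red q) \<or> card (green q) = card (red q) + 1"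
    using assms(2) by (auto simp: is_position_def)
  have fin: "finite (green q)" "finite (red q)" "finite (uncoloured V q)"
    using pos finite_edges[OF assms(1)] by (auto simp: uncoloured_def intro: finite_subset)
  have e: "e \<in> edges V" "e \<notin> green q" "e \<notin> red q"
    using assms(4) by (auto simp: uncoloured_def)
  show ?thesis
  proof (cases "to_move q")
    case PI
    let ?q = "q\<lparr>green := insert e (green q)\<rparr>"
    have q: "make_move e q = ?q" using PI by (simp add: make_move_def)
    have card: "card (green q) = card (red q)"
      using PI by (simp add: to_move_def split: if_splits)
    have unc: "uncoloured V ?q = uncoloured V q - {e}"
      by (auto simp: uncoloured_def)
    have mover: "to_move ?q = PII" using card fin e by (simp add: to_move_def)
    show ?thesis
    proof (cases "has_triangle (insert e (green q))")
      case True
      then show ?thesis by (simp add: q has_lost_def)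
    next
      case False
      then have "mover_wins (uncoloured V q - {e}) (red q) (insert e (green q))"
        using assms(3,4) PI fin unfolding PII_wins_from_def
        by (subst (asm) mover_wins.simps) auto
      then have "PII_wins_from V ?q" by (simp add: PII_wins_from_def mover unc)
      moreover have "is_position V ?q"
        using False pos e card fin by (auto simp: is_position_def)
      ultimately show ?thesis by (simp add: q)
    qed
  next
    case PII
    let ?q = "q\<lparr>red := insert e (red q)\<rparr>"
    have q: "make_move e q = ?q" using PII by (simp add: make_move_def)
    have card: "card (green q) = card (red q) + 1"
      using PII pos by (auto simp: to_move_def split: if_splits)
    have unc: "uncoloured V ?q = uncoloured V q - {e}"
      by (auto simp: uncoloured_def)
    have mover: "to_move ?q = PI" using card fin e by (simp add: to_move_def)
    have reply: "PII_reply V q e" using assms(5) PII by blast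
    then have "PII_wins_from V ?q" by (simp add: PII_wins_from_def PII_reply_def mover unc)
    moreover have "is_position V ?q"
      using reply pos e card fin by (auto simp: is_position_def PII_reply_def)
    ultimately show ?thesis by (simp add: q)
  qed
qed

lemma PII_wins_from_imp_win:
  assumes "finite V" and "card V \<ge> 6" and "is_position V p" and "PII_wins_from V p"
  shows "is_win_for PII V p"
proof -
  \<comment> \<open>The choice depends on the play only through the current position. It is
    meaningful whenever some good reply exists, which the invariant guarantees on PII's
    turn.\<close>
  define s where "s = (\<lambda>es. SOME e. PII_reply V (after p es) e)"
  have s: "PII_reply V (after p es) (s es)"
    if "PII_wins_from V (after p es)" "to_move (after p es) = PII" for es
  proof -
    have "\<exists>e. PII_reply V (after p es) e"
      using that unfolding PII_wins_from_def PII_reply_def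
      by (subst (asm) mover_wins.simps) auto
    then show ?thesis unfolding s_def by (rule someI_ex)
  qed
  \<comment> \<open>A play in which PI has lost cannot be extended, so the inductive step always
    starts from the second disjunct.\<close>
  have invariant: "has_lost PI (after p es) \<or>
      is_position V (after p es) \<and> PII_wins_from V (after p es)"
    if "legal_play V p es" "follows p PII s es" for es
    using that
  proof (induction rule: legal_play.induct)
    case 1
    then show ?case using assms by (simp add: after_def)
  next
    case (2 es e)
    have "\<not> has_lost PI (after p es)" using 2(2) by (simp add: game_over_def)
    then have q: "is_position V (after p es)" "PII_wins_from V (after p es)"
      using 2 by (auto simp: follows_snoc)
    show ?case
      unfolding after_snoc
      using PII_wins_from_move[OF assms(1) q 2(3)] s[of es] q(2) 2(5) by (auto simp: follows_snoc)
  qed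
  have "winning_strategy V p PII s"
    unfolding winning_strategy_def
  proof (intro allI impI conjI)
    fix es
    assume "legal_play V p es \<and> follows p PII s es"
    then have inv: "has_lost PI (after p es) \<or>
        is_position V (after p es) \<and> PII_wins_from V (after p es)"
      using invariant by blast
    show "s es \<in> uncoloured V (after p es)"
      if "\<not> game_over V (after p es) \<and> to_move (after p es) = PII"
      using s[of es] that inv by (auto simp: game_over_def PII_reply_def)
    show "has_lost (opponent PII) (after p es)" if "game_over V (after p es)"
    proof (rule ccontr)
      assume "\<not> has_lost (opponent PII) (after p es)"
      then have pos: "is_position V (after p es)" using inv by simp
      \<comment> \<open>Neither colour contains a triangle here, so the game can only have ended by
        a full board.\<close>
      then have "uncoloured V (after p es) = {}"
        using that by (auto simp: game_over_def has_lost_def is_position_def)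
      then have "edges V \<subseteq> green (after p es) \<union> red (after p es)"
        by (auto simp: uncoloured_def)
      then show False
        using Ramsey_3_3[OF assms(1,2)] pos by (auto simp: is_position_def)
    qed
  qed
  then show ?thesis unfolding is_win_for_def by blast
qed

subsection \<open>Colour-exchanging symmetries of drawn \<open>K\<^sub>5\<close>'s\<close>

lemma partition_on_unique_block:
  assumes "partition_on V P" and "B \<in> P" and "D \<in> P" and "x \<in> B" and "x \<in> D"
  shows "B = D"
  using assms partition_onD2[OF assms(1)] by (auto simp: disjoint_def)

text \<open>Modulo 5, doubling turns differences 1 and -1 into 2 and -2, and those into -1 and 1. So
  every map \<open>2 * m + c\<close> exchanges the pentagon with its complementary pentagram. All
  125 cases are checked.\<close>

lemma doubling_swaps_pentagon:
  fixes a b c :: nat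
  assumes "a < 5" and "b < 5" and "c < 5" and "a \<noteq> b"
  shows "((2 * b + c) mod 5 = ((2 * a + c) mod 5 + 1) mod 5 \<or>
      (2 * a + c) mod 5 = ((2 * b + c) mod 5 + 1) mod 5) \<longleftrightarrow>
    \<not> (b = (a + 1) mod 5 \<or> a = (b + 1) mod 5)"
    and "(2 * a + c) mod 5 \<noteq> (2 * b + c) mod 5"
proof -
  have all: "\<forall>a\<in>{0, 1, 2, 3, 4}. \<forall>b\<in>{0, 1, 2, 3, 4}. \<forall>c\<in>{0, 1, 2, 3, 4 :: nat}. a \<noteq> b \<longrightarrow>
    (((2 * b + c) mod 5 = ((2 * a + c) mod 5 + 1) mod 5 \<or>
      (2 * a + c) mod 5 = ((2 * b + c) mod 5 + 1) mod 5) \<longleftrightarrow>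
    \<not> (b = (a + 1) mod 5 \<or> a = (b + 1) mod 5)) \<and>
    (2 * a + c) mod 5 \<noteq> (2 * b + c) mod 5"
    by simp
  have "a \<in> {0, 1, 2, 3, 4}" "b \<in> {0, 1, 2, 3, 4}" "c \<in> {0, 1, 2, 3, 4}"
    using assms by auto
  note inst = bspec[OF bspec[OF bspec[OF all this(1)] this(2)] this(3), THEN mp, OF assms(4)]
  show "((2 * b + c) mod 5 = ((2 * a + c) mod 5 + 1) mod 5 \<or>
      (2 * a + c) mod 5 = ((2 * b + c) mod 5 + 1) mod 5) \<longleftrightarrow>
    \<not> (b = (a + 1) mod 5 \<or> a = (b + 1) mod 5)"
    using inst by (rule conjunct1)
  show "(2 * a + c) mod 5 \<noteq> (2 * b + c) mod 5"
    using inst by (rule conjunct2)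
qed

text \<open>Transport the doubling map along the numbering of the cycle; the free translation
  constant allows the image of one vertex to be prescribed.\<close>

lemma five_cycle_swap:
  assumes "five_cycle S C" and "x \<in> S" and "y \<in> S"
  shows "\<exists>t. bij_betw t S S \<and> t x = y \<and> (\<forall>e \<in> edges S. t ` e \<in> C \<longleftrightarrow> e \<notin> C)"
proof -
  obtain v :: "nat \<Rightarrow> 'a" where v: "bij_betw v {..<5} S"
    and C: "C = {{v i, v ((i + 1) mod 5)} | i. i < 5}"
    using assms(1) unfolding five_cycle_def by blast
  have v_eq: "v a = v b \<longleftrightarrow> a = b" if "a < 5" "b < 5" for a b
    using v that by (auto simp: bij_betw_def inj_on_def)
  have S: "S = v ` {..<5}" using v by (simp add: bij_betw_def)
  have C_iff: "{v a, v b} \<in> C \<longleftrightarrow> b = (a + 1) mod 5 \<or> a = (b + 1) mod 5"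
    if "a < 5" "b < 5" for a b
  proof -
    have "{v a, v b} \<in> C \<longleftrightarrow> (\<exists>i<5. {v a, v b} = {v i, v ((i + 1) mod 5)})"
      unfolding C by auto
    also have "\<dots> \<longleftrightarrow> (\<exists>i<5. a = i \<and> b = (i + 1) mod 5 \<or> b = i \<and> a = (i + 1) mod 5)"
      using that by (auto simp: doubleton_eq_iff v_eq)
    finally show ?thesis using that by auto
  qed
  obtain i j where ij: "i < 5" "x = v i" "j < 5" "y = v j" using assms(2,3) S by auto
  \<comment> \<open>This solves \<open>2 * i + c = j\<close> modulo 5, because -2 is 3
    there.\<close>
  define c where "c = (3 * i + j) mod 5"
  have "c < 5" by (simp add: c_def)
  define h where "h = (\<lambda>m. (2 * m + c) mod 5)"
  have h: "h m < 5" for m by (simp add: h_def)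
  have "inj_on h {..<5}"
    using doubling_swaps_pentagon(2)[OF _ _ \<open>c < 5\<close>] unfolding inj_on_def h_def by blast
  then have bij_h: "bij_betw h {..<5} {..<5}"
    using h by (simp add: bij_betw_def endo_inj_surj image_subset_iff)
  define t where "t = v \<circ> h \<circ> the_inv_into {..<5} v"
  have t: "t (v m) = v (h m)" if "m < 5" for m
    using that v by (simp add: t_def the_inv_into_f_f bij_betw_def)
  have "bij_betw t S S"
    unfolding t_def
    by (rule bij_betw_trans[OF bij_betw_the_inv_into[OF v] bij_betw_trans[OF bij_h v]])
  moreover have "h i = j" using ij unfolding h_def c_def by presburger
  then have "t x = y" using t ij by simp
  moreover have "t ` e \<in> C \<longleftrightarrow> e \<notin> C" if e: "e \<in> edges S" for e
  proof -
    obtain y z where yz: "e = {y, z}" "y \<in> S" "z \<in> S" "y \<noteq> z" using e by (rule edgesE)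
    moreover obtain a b where "y = v a" "a < 5" "z = v b" "b < 5" using yz(2,3) S by blast
    ultimately have ab: "e = {v a, v b}" "a < 5" "b < 5" "a \<noteq> b" by auto
    then show ?thesis
      using C_iff h t doubling_swaps_pentagon(1)[of a b c] \<open>c < 5\<close> by (simp add: h_def)
  qed
  ultimately show ?thesis by blast
qed

lemma five_cycle_neighbour:
  assumes "five_cycle S C" and "x \<in> S"
  shows "\<exists>y. {x, y} \<in> C"
proof -
  obtain v :: "nat \<Rightarrow> 'a" where v: "bij_betw v {..<5} S"
    and C: "C = {{v i, v ((i + 1) mod 5)} | i. i < 5}"
    using assms(1) unfolding five_cycle_def by blast
  have "S = v ` {..<5}" using v by (simp add: bij_betw_def)
  then obtain i where "i < 5" "x = v i" using assms(2) by blast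
  then have "{x, v ((i + 1) mod 5)} \<in> C" unfolding C by blast
  then show ?thesis ..
qed

text \<open>A colour-exchanging map can be chosen on each block independently, since all edges
  between blocks are uncoloured. The choice fixes \<open>u\<close> on \<open>S\<close> and sends
  \<open>v\<close> to \<open>v'\<close> on \<open>T\<close>.\<close>

lemma swap_symmetry:
  assumes "finite V" and dec: "drawn_K5_decomposition V P p" and pos: "is_position V p"
    and "to_move p = PI"
    and S: "S \<in> P" "u \<in> S" and T: "T \<in> P" "v \<in> T" "v' \<in> T" and "S \<noteq> T"
  shows "\<exists>t. bij t \<and> (`) t ` uncoloured V p = uncoloured V p \<and> (`) t ` green p = red p \<and>
    (`) t ` red p = green p \<and> t u = u \<and> t v = v'"
proof -
  have part: "partition_on V P"
    and drawn: "\<And>B. B \<in> P \<Longrightarrow> five_cycle B (green p \<inter> edges B)"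
      "\<And>B. B \<in> P \<Longrightarrow> red p \<inter> edges B = edges B - green p"
    and cross: "\<And>B D x y. B \<in> P \<Longrightarrow> D \<in> P \<Longrightarrow> B \<noteq> D \<Longrightarrow> x \<in> B \<Longrightarrow> y \<in> D \<Longrightarrow>
      {x, y} \<in> uncoloured V p"
    using dec by (auto simp: drawn_K5_decomposition_def drawn_K5_def)
  have col: "green p \<subseteq> edges V" "red p \<subseteq> edges V"
    using pos by (auto simp: is_position_def)
  have "\<forall>B\<in>P. \<exists>t. bij_betw t B B \<and> (B = S \<longrightarrow> t u = u) \<and> (B = T \<longrightarrow> t v = v') \<and>
      (\<forall>e \<in> edges B. t ` e \<in> green p \<inter> edges B \<longleftrightarrow> e \<notin> green p \<inter> edges B)"
  proof
    fix B assume B: "B \<in> P"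
    then obtain z where "z \<in> B" using part by (metis partition_onD3 equals0I)
    then show "\<exists>t. bij_betw t B B \<and> (B = S \<longrightarrow> t u = u) \<and> (B = T \<longrightarrow> t v = v') \<and>
      (\<forall>e \<in> edges B. t ` e \<in> green p \<inter> edges B \<longleftrightarrow> e \<notin> green p \<inter> edges B)"
      using five_cycle_swap[OF drawn(1)[OF B], of z z] five_cycle_swap[OF drawn(1)[OF B], of u u]
        five_cycle_swap[OF drawn(1)[OF B], of v v'] S T \<open>S \<noteq> T\<close> by metis
  qed
  then obtain r where r: "\<And>B. B \<in> P \<Longrightarrow> bij_betw (r B) B B" "r S u = u" "r T v = v'"
    and swap: "\<And>B e. B \<in> P \<Longrightarrow> e \<in> edges B \<Longrightarrow>
      r B ` e \<in> green p \<inter> edges B \<longleftrightarrow> e \<notin> green p \<inter> edges B"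
    using S T bchoice by (metis (no_types, lifting))
  \<comment> \<open>Glue the block maps \<open>r B\<close>. The identity outside \<open>V\<close>
    makes \<open>t\<close> a bijection of the whole type, as \<open>mover_wins_image\<close>
    requires.\<close>
  define t where "t x = (if x \<in> V then r (THE B. B \<in> P \<and> x \<in> B) x else x)" for x
  have V: "V = \<Union>P" using part by (rule partition_onD1)
  have t: "t x = r B x" if "B \<in> P" "x \<in> B" for x B
  proof -
    have "(THE B. B \<in> P \<and> x \<in> B) = B"
      using that partition_on_unique_block[OF part] by (intro the_equality) blast+
    then show ?thesis using that V by (auto simp: t_def)
  qed
  have t_img: "t ` e = r B ` e" if "B \<in> P" "e \<subseteq> B" for e B
    using t that by (auto intro!: image_cong)
  have tB: "t x \<in> B" if "B \<in> P" "x \<in> B" for x B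
    using t[OF that] bij_betwE[OF r(1)[OF that(1)]] that(2) by simp
  have inj_V: "inj_on t V"
  proof (rule inj_onI)
    fix x y assume xy: "x \<in> V" "y \<in> V" "t x = t y"
    then obtain B D where BD: "B \<in> P" "D \<in> P" "x \<in> B" "y \<in> D" using V by blast
    then have "B = D" using tB xy(3) part by (metis partition_on_unique_block)
    then show "x = y" using BD xy(3) t r(1) by (metis bij_betw_def inj_on_def)
  qed
  have t_V: "t ` V \<subseteq> V" using tB V by blast
  have bij_V: "bij_betw t V V"
    using inj_V t_V endo_inj_surj[OF assms(1)] by (auto simp: bij_betw_def)
  have "bij_betw t (- V) (- V)"
    by (auto simp: bij_betw_def t_def inj_on_def image_def)
  then have bij: "bij t"
    using bij_betw_combine[OF bij_V] by (metis Compl_disjoint Compl_partition)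
  have inj: "inj ((`) t)"
    using bij_is_inj[OF bij] by (simp add: inj_def inj_image_eq_iff)
  have card_t: "card (t ` e) = card e" for e
    using bij_is_inj[OF bij] by (metis card_image inj_on_subset subset_UNIV)
  have in_block: "\<exists>B\<in>P. e \<in> edges B" if "e \<in> green p \<union> red p" for e
  proof -
    have "e \<in> edges V" using that col by blast
    then obtain x y where xy: "e = {x, y}" "x \<in> V" "y \<in> V" "x \<noteq> y"
      by (rule edgesE)
    then obtain B D where BD: "B \<in> P" "D \<in> P" "x \<in> B" "y \<in> D" using V by blast
    have "B = D" using cross[OF BD(1,2) _ BD(3,4)] that xy(1) by (auto simp: uncoloured_def)
    then show ?thesis using BD xy by auto
  qed
  have t_block: "t ` e \<in> edges B" "t ` e \<in> green p \<longleftrightarrow> e \<notin> green p"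
    if "B \<in> P" "e \<in> edges B" for e B
  proof -
    show 1: "t ` e \<in> edges B" using that tB card_t by (auto simp: edges_def)
    show "t ` e \<in> green p \<longleftrightarrow> e \<notin> green p"
      using swap[OF that] t_img[OF that(1), of e] that(2) 1 by (auto simp: edges_def)
  qed
  have fin: "finite (green p)" "finite (red p)" "finite (edges V)"
    using col finite_edges[OF assms(1)] by (auto intro: finite_subset)
  have card: "card (green p) = card (red p)"
    using \<open>to_move p = PI\<close> by (simp add: to_move_def split: if_splits)
  have card_image: "card ((`) t ` A) = card A" for A
    using inj by (metis card_image inj_on_subset subset_UNIV)
  \<comment> \<open>Inclusions suffice: \<open>t\<close> acts injectively on edges, and PI being on
    turn means that both colours have equally many.\<close>
  have "(`) t ` green p \<subseteq> red p"
    using in_block t_block drawn(2) by blast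
  then have green: "(`) t ` green p = red p"
    using fin card card_image by (simp add: card_subset_eq)
  have "(`) t ` red p \<subseteq> green p"
    using in_block t_block drawn(2) by blast
  then have red: "(`) t ` red p = green p"
    using fin card card_image by (simp add: card_subset_eq)
  have "(`) t ` edges V \<subseteq> edges V"
    using t_V card_t by (auto simp: edges_def)
  then have "(`) t ` edges V = edges V"
    using fin card_image by (simp add: card_subset_eq)
  then have "(`) t ` uncoloured V p = uncoloured V p"
    using inj green red by (simp add: uncoloured_def image_set_diff image_Un Un_commute)
  then show ?thesis using bij green red t r S T by metis
qed

theorem theorem1:
  fixes V :: "'a set" and n :: nat and P :: "'a set set" and p :: "'a colouring"
  assumes "finite V" and "card V = n"
    and "5 dvd n" and "n \<ge> 6"
    and "is_position V p"
    and "drawn_K5_decomposition V P p"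
    and "to_move p = PI"
  shows "is_win_for PII V p"
proof -
  have part: "partition_on V P" and drawn: "\<And>B. B \<in> P \<Longrightarrow> drawn_K5 p B"
    using assms(6) by (auto simp: drawn_K5_decomposition_def)
  have "\<not> mover_wins (uncoloured V p) (green p) (red p)"
  proof (rule not_mover_wins_self_dual)
    show "finite (uncoloured V p)"
      using finite_edges[OF assms(1)] by (simp add: uncoloured_def)
  next
    fix e assume e: "e \<in> uncoloured V p"
    then obtain u v where uv: "e = {u, v}" "u \<in> V" "v \<in> V" "u \<noteq> v"
      unfolding uncoloured_def by (blast elim: edgesE)
    then obtain S T where ST: "S \<in> P" "T \<in> P" "u \<in> S" "v \<in> T"
      using partition_onD1[OF part] by blast
    \<comment> \<open>Inside a block every edge is coloured, so a playable edge joins two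
      blocks.\<close>
    have "S \<noteq> T"
    proof
      assume "S = T"
      then have "e \<in> edges S" using uv ST by simp
      then show False
        using drawn[OF ST(1)] e by (auto simp: drawn_K5_def uncoloured_def)
    qed
    have "five_cycle T (green p \<inter> edges T)" using drawn[OF ST(2)] by (simp add: drawn_K5_def)
    from five_cycle_neighbour[OF this ST(4)]
    obtain v' where v': "{v, v'} \<in> green p" "{v, v'} \<in> edges T"
      by (elim exE IntE)
    then have "v' \<in> T" "v' \<noteq> v" by auto
    have "u \<notin> T" using ST \<open>S \<noteq> T\<close> part by (metis partition_on_unique_block)
    then have "u \<noteq> v'" using \<open>v' \<in> T\<close> by blast
    \<comment> \<open>The triangle on \<open>u\<close>, \<open>v\<close>, \<open>v'\<close>: its
      third side is the green edge \<open>{v, v'}\<close> of the block \<open>T\<close>.\<close>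
    have "has_triangle (insert {u, v'} (insert e (green p)))"
      unfolding has_triangle_def
      using uv \<open>v' \<noteq> v\<close> \<open>u \<noteq> v'\<close> v'(1) by (intro exI[of _ u] exI[of _ v] exI[of _ v']) auto
    moreover have "{u, v'} \<noteq> e"
      using uv \<open>v' \<noteq> v\<close> \<open>u \<noteq> v'\<close> by (auto simp: doubleton_eq_iff)
    moreover obtain t where "bij t" "(`) t ` uncoloured V p = uncoloured V p"
        "(`) t ` green p = red p" "(`) t ` red p = green p" "t u = u" "t v = v'"
      using swap_symmetry[OF assms(1,6,5,7) ST(1,3,2,4) \<open>v' \<in> T\<close> \<open>S \<noteq> T\<close>] by blast
    ultimately show "\<exists>t f. bij t \<and> (`) t ` uncoloured V p = uncoloured V p \<and>
        (`) t ` green p = red p \<and> (`) t ` red p = green p \<and> t ` e = f \<and>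
        f \<noteq> e \<and> has_triangle (insert f (insert e (green p)))"
      using uv(1) by (intro exI[of _ t] exI[of _ "{u, v'}"]) simp
  qed
  then have "PII_wins_from V p" by (simp add: PII_wins_from_def assms(7))
  then show ?thesis
    using PII_wins_from_imp_win assms by blast
qed

end
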